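(* Let $0<a_-<a_+<1$ and $0<b_-<b_+<\infty$. There exists $C>0$ such that $$|E_{a,b}(-t)|\le\frac{C}{1+t}$$ for all $t\ge0$, $a\in[a_-,a_+]$, and $b\in[b_-,b_+]$.
   Context: For $a,b>0$, $E_{a,b}(z):=\sum_{k=0}^\infty\frac{z^k}{\Gamma(ak+b)}$, $z\in\mathbb C$, is the two-parameter Mittag--Leffler function. *)

theory Defs
  imports "HOL-Analysis.Analysis"
begin

(* Intended for a, b > 0: then every Gamma argument is positive and the series
   converges for every complex z, so the value of suminf is the genuine sum. *)
definition mittag_leffler :: "real \<Rightarrow> real \<Rightarrow> complex \<Rightarrow> complex" where
  "mittag_leffler a b z = (\<Sum>k. z ^ k / complex_of_real (Gamma (a * real k + b)))"

end

theory Submission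
  imports Defs "HOL-Complex_Analysis.Residue_Theorem"
begin

text \<open>Write \<open>E a b\<close> for the Mittag-Leffler function.
For \<open>t \<ge> 1\<close> and \<open>0 < a < 1\<close> the value \<open>E a b (-t)\<close> equals the Mellin--Barnes integral
\<open>J b = 1 / (2 pi \<i>) \<integral> pi / sin (pi s) \<cdot> t powr (- s) / Gamma (b - a s) ds\<close> over the line \<open>Re s = 1/2\<close>.
Since \<open>1 / Gamma (x + \<i> y)\<close> is \<open>O (exp (pi \<bar>y\<bar>))\<close> uniformly for \<open>x \<ge> -2\<close>,
the integrand is \<open>O (exp (- pi (1 - a) \<bar>y\<bar>))\<close>, with
a constant independent of \<open>a\<close> and of \<open>b > -1\<close>. Hence \<open>J\<close> is bounded uniformly in \<open>b > -1\<close> and in \<open>a\<close>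
bounded away from \<open>1\<close>.

Moving the line to \<open>Re s = -1/2\<close> picks up the pole at the origin, and replacing \<open>s\<close> by \<open>s - 1\<close> moves it
back. This gives the recurrence \<open>J b = 1 / Gamma b - t J (b + a)\<close> (lemma \<open>mellin_barnes_recurrence\<close>),
which is used twice. Iterated upwards it reproduces the power series of \<open>E\<close>, with a remainder that
vanishes because \<open>1 / Gamma\<close> decays superexponentially to the right; so \<open>J b = E a b (-t)\<close>. Used once
downwards, at \<open>b - a\<close>, it reads \<open>t E a b (-t) = 1 / Gamma (b - a) - J (b - a)\<close>. The right-hand side is
bounded, and this is the asserted decay. For \<open>t \<le> 1\<close> the power series is bounded term by term.\<close>

section \<open>Growth of the reciprocal Gamma function\<close>

lemma norm_Gamma_le_Gamma_Re:
  assumes "Re z > 0"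
  shows "norm (Gamma z) \<le> Gamma (Re z)"
proof -
  have "norm (integral {0..} (\<lambda>t. of_real t powr (z - 1) / of_real (exp t)))
      \<le> integral {0..} (\<lambda>t. t powr (Re z - 1) / exp t)"
  proof (rule Henstock_Kurzweil_Integration.integral_norm_bound_integral)
    show "(\<lambda>t. of_real t powr (z - 1) / of_real (exp t)) integrable_on {0..}"
      using Gamma_integral_complex[OF assms] by (rule has_integral_integrable)
    show "(\<lambda>t. t powr (Re z - 1) / exp t) integrable_on {0..}"
      using Gamma_integral_real[OF assms] by (rule has_integral_integrable)
    show "norm (of_real t powr (z - 1) / of_real (exp t)) \<le> t powr (Re z - 1) / exp t"
      if "t \<in> {0..}" for t :: real
      using that by (simp add: norm_divide norm_powr_real_powr)
  qed
  then show ?thesis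
    using Gamma_integral_complex[OF assms] Gamma_integral_real[OF assms]
    by (simp add: integral_unique)
qed

text \<open>Reflection turns \<^term>\<open>rGamma\<close> into \<^term>\<open>Gamma\<close> times a sine. The Gamma factor is largest on the real axis,
so the sine alone accounts for the growth along vertical lines. The true rate is \<open>pi/2\<close>;
\<open>pi\<close> is enough, because the argument \<open>b - a s\<close> slows the growth by the factor \<open>a < 1\<close>.\<close>
lemma norm_rGamma_le_reflected:
  assumes "x < 1"
  shows "norm (rGamma (Complex x y)) \<le> Gamma (1 - x) * exp (pi * \<bar>y\<bar>)"
proof -
  let ?z = "Complex x y"
  have nz: "1 - ?z \<notin> \<int>\<^sub>\<le>\<^sub>0"
    using assms by (auto elim!: nonpos_Ints_cases simp: complex_eq_iff)
  have "rGamma ?z * rGamma (1 - ?z) = sin (of_real pi * ?z) / of_real pi"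
    by (rule rGamma_reflection_complex)
  then have eq: "rGamma ?z = Gamma (1 - ?z) * (sin (of_real pi * ?z) / of_real pi)"
    using nz by (simp add: Gamma_def rGamma_eq_zero_iff field_simps)
  have "norm (sin (of_real pi * ?z) / of_real pi) = norm (sin (of_real pi * ?z)) / pi"
    by (simp add: norm_divide)
  also have "\<dots> \<le> exp (pi * \<bar>y\<bar>) / 1"
    using cmod_sin_le_exp[of 1 "of_real pi * ?z"] pi_ge_two
    by (intro frac_le) (simp_all add: abs_mult)
  finally have "norm (sin (of_real pi * ?z) / of_real pi) \<le> exp (pi * \<bar>y\<bar>)"
    by simp
  then show ?thesis
    unfolding eq norm_mult using norm_Gamma_le_Gamma_Re[of "1 - ?z"] assms
    by (intro mult_mono) (simp_all del: norm_divide)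
qed

lemma norm_rGamma_shift:
  assumes "z \<noteq> 1"
  shows "norm (rGamma z) = norm (rGamma (z - 1)) / norm (z - 1)"
  using rGamma_plus1[of "z - 1"] assms by (simp add: norm_mult[symmetric] divide_simps)
    (metis norm_mult mult.commute)

text \<open>For \<open>x \<le> 0\<close> this is reflection. Moving right by one divides \<^term>\<open>rGamma\<close> by \<open>z - 1\<close>, which has
modulus at least \<open>1\<close> unless \<open>z\<close> is close to the real axis and \<open>x < 2\<close>; that remaining region is
compact. The left end \<open>-2\<close> leaves room for the arguments \<open>b - a - a/2 > -3/2\<close> needed later.\<close>
lemma rGamma_strip_bound:
  "\<exists>B\<ge>0. \<forall>x\<ge>-2. \<forall>y. norm (rGamma (Complex x y)) \<le> B * exp (pi * \<bar>y\<bar>)"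
proof -
  have "compact ((\<lambda>x. Gamma (1 - x)) ` {-2..0::real})"
    by (intro compact_continuous_image compact_Icc continuous_on_compose2[OF continuous_on_Gamma[of "{1..}"]]
          continuous_intros) (auto elim!: nonpos_Ints_cases)
  then obtain B1 where "\<forall>v \<in> (\<lambda>x. Gamma (1 - x)) ` {-2..0::real}. norm v \<le> B1"
    using compact_imp_bounded bounded_iff by blast
  then have B1: "norm (Gamma (1 - x)) \<le> B1" if "-2 \<le> x" "x \<le> 0" for x :: real
    using that by (simp del: real_norm_def)
  have low: "norm (rGamma (Complex x y)) \<le> B1 * exp (pi * \<bar>y\<bar>)" if "-2 \<le> x" "x \<le> 0" for x y
  proof -
    have "norm (rGamma (Complex x y)) \<le> Gamma (1 - x) * exp (pi * \<bar>y\<bar>)"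
      using that by (intro norm_rGamma_le_reflected) auto
    also have "\<dots> \<le> B1 * exp (pi * \<bar>y\<bar>)"
      using B1[OF that] by (intro mult_right_mono) auto
    finally show ?thesis .
  qed
  have "compact (rGamma ` (cbox (Complex (-2) (-1)) (Complex 2 1)))"
    by (intro compact_continuous_image compact_cbox continuous_intros)
  then obtain B2 where B2: "\<And>z. z \<in> cbox (Complex (-2) (-1)) (Complex 2 1) \<Longrightarrow> norm (rGamma z) \<le> B2"
    using compact_imp_bounded bounded_iff by (metis imageI)
  define B where "B = max B1 B2"
  have B0: "B \<ge> 0"
    using B2[of 0] by (simp add: B_def in_cbox_complex_iff le_max_iff_disj)
  have small: "norm (rGamma (Complex x y)) \<le> B * exp (pi * \<bar>y\<bar>)"
    if "-2 \<le> x" "x \<le> 2" "\<bar>y\<bar> \<le> 1" for x y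
  proof -
    have "norm (rGamma (Complex x y)) \<le> B * 1"
      using B2[of "Complex x y"] that by (simp add: B_def in_cbox_complex_iff abs_le_iff le_max_iff_disj)
    also have "\<dots> \<le> B * exp (pi * \<bar>y\<bar>)"
      using B0 by (intro mult_left_mono) auto
    finally show ?thesis .
  qed
  have "norm (rGamma (Complex x y)) \<le> B * exp (pi * \<bar>y\<bar>)" if "-2 \<le> x" "x \<le> real n" for n x y
    using that
  proof (induction n arbitrary: x)
    case 0
    then show ?case
      using low[of x y] by (smt (verit) B_def exp_ge_zero max.cobounded1 mult_right_mono of_nat_0)
  next
    case (Suc n)
    consider "x \<le> real n" | "x > real n" "x \<le> 2" "\<bar>y\<bar> \<le> 1" | "x > real n" "x > 2 \<or> \<bar>y\<bar> > 1"
      by linarith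
    then show ?case
    proof cases
      case 1 then show ?thesis using Suc by simp
    next
      case 2 then show ?thesis using Suc small by simp
    next
      case 3
      let ?z = "Complex x y"
      have "norm (?z - 1) \<ge> 1"
        using 3 abs_Re_le_cmod[of "?z - 1"] abs_Im_le_cmod[of "?z - 1"] by auto
      moreover from this have "?z \<noteq> 1" by auto
      ultimately have "norm (rGamma ?z) \<le> norm (rGamma (?z - 1))"
        using norm_rGamma_shift[of ?z] divide_left_mono[of 1 "norm (?z - 1)" "norm (rGamma (?z - 1))"]
        by simp
      moreover have "?z - 1 = Complex (x - 1) y" by (simp add: complex_eq_iff)
      ultimately show ?thesis
        using Suc.IH[of "x - 1"] 3 Suc.prems by auto
    qed
  qed
  then have "norm (rGamma (Complex x y)) \<le> B * exp (pi * \<bar>y\<bar>)" if "-2 \<le> x" for x y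
    using that real_arch_simple[of x] by blast
  then show ?thesis
    using B0 by blast
qed

text \<open>Once \<open>x > D + 1\<close>, each step to the right divides \<^term>\<open>rGamma\<close> by a number of modulus at least \<open>D\<close>;
the bounded part to the left is absorbed by the constant. The freedom in \<open>D\<close> is what lets the
remainders \<open>t\<^sup>n rGamma (b + n a - \<dots>)\<close> tend to zero for every \<open>t\<close>.\<close>
lemma rGamma_superexponential_bound:
  assumes "D \<ge> 1"
  shows "\<exists>B\<ge>0. \<forall>x\<ge>-2. \<forall>y. norm (rGamma (Complex x y)) \<le> B * exp (pi * \<bar>y\<bar>) * D powr (-x)"
proof -
  obtain B0 where B0: "B0 \<ge> 0"
    "\<And>x y. -2 \<le> x \<Longrightarrow> norm (rGamma (Complex x y)) \<le> B0 * exp (pi * \<bar>y\<bar>)"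
    using rGamma_strip_bound by blast
  define B where "B = B0 * D powr (D + 1)"
  have B: "B \<ge> 0" using B0 by (simp add: B_def)
  have *: "norm (rGamma (Complex x y)) \<le> B * exp (pi * \<bar>y\<bar>) * D powr (-x)"
    if "-2 \<le> x" "x \<le> D + 1 + real n" for n x y
    using that
  proof (induction n arbitrary: x)
    case 0
    have "norm (rGamma (Complex x y)) \<le> B0 * exp (pi * \<bar>y\<bar>) * 1"
      using B0(2) 0 by simp
    also have "\<dots> \<le> B0 * exp (pi * \<bar>y\<bar>) * D powr (D + 1 - x)"
      using 0 assms B0(1) by (intro mult_left_mono) (auto intro: ge_one_powr_ge_zero)
    also have "\<dots> = B * exp (pi * \<bar>y\<bar>) * D powr (-x)"
      using assms by (simp add: B_def powr_diff powr_minus divide_simps)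
    finally show ?case .
  next
    case (Suc n)
    show ?case
    proof (cases "x \<le> D + 1 + real n")
      case True then show ?thesis using Suc by simp
    next
      case False
      let ?z = "Complex x y"
      have "norm (?z - 1) \<ge> D"
        using False assms abs_Re_le_cmod[of "?z - 1"] by auto
      moreover have "?z \<noteq> 1" using False assms by (auto simp: complex_eq_iff)
      moreover have "?z - 1 = Complex (x - 1) y" by (simp add: complex_eq_iff)
      ultimately have "norm (rGamma ?z) \<le> norm (rGamma (Complex (x - 1) y)) / D"
        using norm_rGamma_shift[of ?z] assms
          frac_le[of "norm (rGamma (?z - 1))" "norm (rGamma (?z - 1))" D "norm (?z - 1)"] by simp
      also have "\<dots> \<le> (B * exp (pi * \<bar>y\<bar>) * D powr (-(x - 1))) / D"
        using Suc False assms by (intro divide_right_mono Suc.IH) auto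
      also have "\<dots> = B * exp (pi * \<bar>y\<bar>) * D powr (-x)"
        using assms by (simp add: powr_diff powr_minus divide_simps)
      finally show ?thesis .
    qed
  qed
  have "norm (rGamma (Complex x y)) \<le> B * exp (pi * \<bar>y\<bar>) * D powr (-x)" if "-2 \<le> x" for x y
  proof -
    obtain n where "x - (D + 1) \<le> real n" using real_arch_simple by blast
    with that show ?thesis by (intro *[where n = n]) auto
  qed
  then show ?thesis using B by blast
qed

section \<open>The Poisson formula for a strip\<close>

lemma integrable_exp_minus_abs:
  assumes "c > 0"
  shows "(\<lambda>y::real. exp (- c * \<bar>y\<bar>)) integrable_on UNIV"
proof -
  have a: "(\<lambda>y::real. exp (- c * \<bar>y\<bar>)) integrable_on {0..}"
    using integrable_on_exp_minus_to_infinity[OF assms, of 0]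
    by (rule integrable_eq) auto
  have b: "(\<lambda>y::real. exp (- c * \<bar>y\<bar>)) integrable_on {..0}"
  proof -
    have "(\<lambda>y::real. exp (- c * \<bar>y\<bar>)) absolutely_integrable_on {0..}"
      using a by (intro nonnegative_absolutely_integrable_1) auto
    then have "(\<lambda>y::real. exp (- c * \<bar>- y\<bar>)) absolutely_integrable_on {..0}"
      by (subst has_absolute_integral_reflect_real[of "{..0}" "{0..}", THEN iffD2, THEN conjunct1]) auto
    then show ?thesis
      by (simp add: set_lebesgue_integral_eq_integral(1))
  qed
  have "{..0} \<inter> {0..} = {0::real}" "{..0} \<union> {0..} = (UNIV :: real set)" by auto
  then show ?thesis
    using integrable_Un[OF _ b a] by simp
qed

text \<open>The weight is the kernel \<open>pi / sin (pi s)\<close> on the lines \<open>Re s = \<plusminus>1/2\<close>, up to sign and the factor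
\<open>2 pi\<close>. It decays like \<open>exp (- pi \<bar>y\<bar>)\<close> and so beats any \<open>\<theta> < pi\<close>.\<close>
lemma sech_weighted_integral:
  fixes h :: "real \<Rightarrow> complex"
  assumes cont: "continuous_on UNIV h" and "\<theta> < pi"
    and bound: "\<And>y. norm (h y) \<le> K * exp (\<theta> * \<bar>y\<bar>)"
  shows sech_weighted_integral_limit:
      "(\<lambda>n. integral {- real n..real n} (\<lambda>y. h y / of_real (2 * cosh (pi * y))))
         \<longlonglongrightarrow> integral UNIV (\<lambda>y. h y / of_real (2 * cosh (pi * y)))"
    and norm_sech_weighted_integral_le:
      "norm (integral UNIV (\<lambda>y. h y / of_real (2 * cosh (pi * y))))
         \<le> K * integral UNIV (\<lambda>y. exp (- (pi - \<theta>) * \<bar>y\<bar>))"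
proof -
  let ?f = "\<lambda>y. h y / of_real (2 * cosh (pi * y))"
  let ?m = "\<lambda>y::real. K * exp (- (pi - \<theta>) * \<bar>y\<bar>)"
  let ?fn = "\<lambda>n y. if y \<in> {- real n..real n} then ?f y else 0"
  have m: "?m integrable_on UNIV"
    using integrable_exp_minus_abs[of "pi - \<theta>"] assms(2) by (intro integrable_on_mult_right) auto
  have le: "norm (?f y) \<le> ?m y" for y
  proof -
    have "exp (pi * \<bar>y\<bar>) \<le> 2 * cosh (pi * y)"
      by (cases "y \<ge> 0") (auto simp: cosh_def)
    then have "norm (?f y) \<le> (K * exp (\<theta> * \<bar>y\<bar>)) / exp (pi * \<bar>y\<bar>)"
      unfolding norm_divide using bound[of y] order_trans[OF norm_ge_zero bound[of y]]
      by (intro frac_le) auto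
    also have "\<dots> = ?m y"
      by (simp add: exp_minus exp_diff[symmetric] divide_inverse mult_exp_exp algebra_simps flip: exp_minus)
    finally show ?thesis .
  qed
  have cf: "continuous_on A ?f" for A
    by (intro continuous_intros continuous_on_subset[OF cont]) auto
  have "?fn n integrable_on UNIV" for n
    using integrable_continuous_real[OF cf, of "- real n" "real n"]
    by (simp only: integrable_restrict_UNIV)
  moreover have "norm (?fn n y) \<le> ?m y" for n y
    using le[of y] norm_ge_zero[of "?f y"] by (auto simp del: norm_ge_zero intro: order_trans)
  moreover have "(\<lambda>n. ?fn n y) \<longlonglongrightarrow> ?f y" for y
  proof (rule tendsto_eventually)
    show "\<forall>\<^sub>F n in sequentially. ?fn n y = ?f y"
      using eventually_ge_at_top[of "nat \<lceil>\<bar>y\<bar>\<rceil>"]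
      by eventually_elim (use abs_le_iff in \<open>auto simp: nat_le_iff ceiling_le_iff\<close>)
  qed
  ultimately have "?f integrable_on UNIV \<and> (\<lambda>n. integral UNIV (?fn n)) \<longlonglongrightarrow> integral UNIV ?f"
    using dominated_convergence[of ?fn UNIV ?m ?f] m by blast
  then have int: "?f integrable_on UNIV"
    and lim: "(\<lambda>n. integral {- real n..real n} ?f) \<longlonglongrightarrow> integral UNIV ?f"
    by (simp_all only: integral_restrict_UNIV)
  show "(\<lambda>n. integral {- real n..real n} ?f) \<longlonglongrightarrow> integral UNIV ?f"
    by (rule lim)
  show "norm (integral UNIV ?f) \<le> K * integral UNIV (\<lambda>y. exp (- (pi - \<theta>) * \<bar>y\<bar>))"
    using integral_norm_bound_integral[OF int m] le by (simp only: integral_mult_right)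
qed

lemma norm_sin_ge_sinh: "\<bar>sinh (Im z)\<bar> \<le> norm (sin z)"
proof -
  have "(exp (Im z) - exp (- Im z))\<^sup>2 = exp (2 * Im z) + inverse (exp (2 * Im z)) - 2"
    by (simp add: power2_eq_square algebra_simps flip: exp_minus exp_add mult_exp_exp)
  then have "(sinh (Im z))\<^sup>2 \<le> (norm (sin z))\<^sup>2"
    unfolding norm_sin_squared sinh_def by (simp add: power_divide)
  then show ?thesis
    by (simp add: abs_le_square_iff[symmetric])
qed

lemma sin_pi_half_line:
  "sin (of_real pi * Complex (1/2) y) = of_real (cosh (pi * y))"
  "sin (of_real pi * Complex (-(1/2)) y) = - of_real (cosh (pi * y))"
  by (simp_all add: complex_eq_iff Re_sin Im_sin cosh_def field_simps)

lemma sin_pi_eq_0_strip: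
  assumes "\<bar>Re z\<bar> < 1" "sin (of_real pi * z) = 0"
  shows "z = 0"
proof -
  obtain n :: int where "of_real pi * z = of_real (of_int n * pi)"
    using assms(2) by (auto simp: sin_eq_0)
  then have "z = of_int n" by simp
  with assms(1) show ?thesis by simp
qed

text \<open>The origin is the only zero of \<open>sin (pi w)\<close> in the strip \<open>\<bar>Re w\<bar> < 1\<close>, which contains the rectangle,
and \<open>pi / sin (pi w)\<close> has residue \<open>1\<close> at it.\<close>
lemma contour_integral_rectpath_pi_over_sin:
  assumes holo: "g holomorphic_on UNIV" and "T > 0"
  shows "contour_integral (rectpath (Complex (-1/2) (-T)) (Complex (1/2) T))
           (\<lambda>w. of_real pi * g w / sin (of_real pi * w)) = 2 * of_real pi * \<i> * g 0"
proof -
  let ?S = "{z. \<bar>Re z\<bar> < 1}"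
  let ?h = "\<lambda>w. of_real pi * g w / sin (of_real pi * w)"
  let ?P = "rectpath (Complex (-1/2) (-T)) (Complex (1/2) T)"
  have S_eq: "?S = {z. Re z < 1} \<inter> {z. -1 < Re z}" by auto
  have "open ?S" "convex ?S"
    unfolding S_eq by (auto intro!: open_Int open_halfspace_Re_lt open_halfspace_Re_gt
        convex_Int convex_halfspace_Re_lt convex_halfspace_Re_gt)
  have g: "g holomorphic_on A" for A
    using holo holomorphic_on_subset by blast
  have h: "?h holomorphic_on ?S - {0}"
    by (intro holomorphic_intros g) (use sin_pi_eq_0_strip in auto)
  have path: "path_image ?P \<subseteq> ?S - {0}"
    using \<open>T > 0\<close> by (subst path_image_rectpath) auto
  have inside: "winding_number ?P 0 = 1"
    using \<open>T > 0\<close> by (intro winding_number_rectpath) (auto simp: in_box_complex_iff)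
  have outside: "\<forall>z. z \<notin> ?S \<longrightarrow> winding_number ?P z = 0"
    using \<open>T > 0\<close> by (auto intro!: winding_number_rectpath_outside simp: in_cbox_complex_iff)
  have residue: "residue ?h 0 = g 0"
  proof (rule residue_simple'[of ?S])
    have "((\<lambda>w. sin (of_real pi * w)) has_field_derivative of_real pi) (at (0 :: complex))"
      by (auto intro!: derivative_eq_intros)
    then have "(\<lambda>w. sin (of_real pi * w) / w) \<midarrow>(0 :: complex)\<rightarrow> of_real pi"
      by (simp add: has_field_derivative_iff)
    moreover have "g \<midarrow>0\<rightarrow> g 0"
      using holomorphic_on_imp_continuous_on[OF g[of UNIV]]
      by (simp add: continuous_on_eq_continuous_at isCont_def)
    ultimately have "(\<lambda>w. of_real pi * g w / (sin (of_real pi * w) / w)) \<midarrow>0\<rightarrow> of_real pi * g 0 / of_real pi"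
      by (intro tendsto_intros) auto
    then show "(\<lambda>w. ?h w * (w - 0)) \<midarrow>0\<rightarrow> g 0"
      by simp
  qed (use h \<open>open ?S\<close> in auto)
  have "contour_integral ?P ?h = 2 * pi * \<i> * (\<Sum>p\<in>{0}. winding_number ?P p * residue ?h p)"
    using h path outside \<open>open ?S\<close> \<open>convex ?S\<close>
    by (intro Residue_theorem[where S = ?S]) (auto intro: convex_connected)
  then show ?thesis
    using inside residue by simp
qed

text \<open>Poisson's formula for a strip at its centre. As the rectangle of the previous lemma grows in
height, its horizontal sides contribute \<open>O (exp ((\<theta> - pi) T))\<close>. The two vertical sides run in opposite
directions, but \<open>sin (pi w)\<close> also changes sign between them, so their integrals add up.\<close>
lemma strip_mean_value:
  assumes holo: "g holomorphic_on UNIV" and "\<theta> < pi"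
    and bound: "\<And>z. \<bar>Re z\<bar> \<le> 1/2 \<Longrightarrow> norm (g z) \<le> K * exp (\<theta> * \<bar>Im z\<bar>)"
  shows "g 0 = integral UNIV (\<lambda>y. g (Complex (1/2) y) / of_real (2 * cosh (pi * y)))
             + integral UNIV (\<lambda>y. g (Complex (-1/2) y) / of_real (2 * cosh (pi * y)))"
proof -
  let ?h = "\<lambda>w. of_real pi * g w / sin (of_real pi * w)"
  let ?f = "\<lambda>c y. g (Complex c y) / of_real (2 * cosh (pi * y))"
  let ?I = "\<lambda>c n. integral {- real n..real n} (?f c)"
  have g: "continuous_on A g" for A
    using holo holomorphic_on_imp_continuous_on continuous_on_subset by blast
  have line: "continuous_on UNIV (\<lambda>y. g (Complex c y))" for c
    by (intro continuous_on_compose2[OF g[of UNIV]] continuous_intros) auto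
  have lim: "?I c \<longlonglongrightarrow> integral UNIV (?f c)" if "\<bar>c\<bar> \<le> 1/2" for c
    using bound[of "Complex c _"] that
    by (intro sech_weighted_integral_limit[OF line \<open>\<theta> < pi\<close>, of _ K]) simp
  have "K \<ge> 0"
    using order_trans[OF norm_ge_zero bound[of 0]] by simp
  have horizontal: "norm (contour_integral (linepath p q) ?h)
      \<le> 4 * K * pi * exp (- (pi - \<theta>) * T) * norm (q - p)"
    and integrable: "?h contour_integrable_on linepath p q"
    if "T \<ge> 1" and pq: "\<bar>Re p\<bar> \<le> 1/2" "\<bar>Re q\<bar> \<le> 1/2" "Im p = Im q" "\<bar>Im p\<bar> = T" for p q T
  proof -
    have seg: "\<bar>Re z\<bar> \<le> 1/2" "\<bar>Im z\<bar> = T" if "z \<in> closed_segment p q" for z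
    proof -
      from that pq(3) have "Im z = Im p" "Re z \<in> closed_segment (Re p) (Re q)"
        by (auto simp: closed_segment_same_Im)
      with pq show "\<bar>Re z\<bar> \<le> 1/2" "\<bar>Im z\<bar> = T"
        by (auto simp: closed_segment_eq_real_ivl split: if_splits)
    qed
    \<comment> \<open>The zeros of the sine are real, and the segment has distance at least \<open>1\<close> from the real axis.\<close>
    have sin_ge: "exp (pi * T) / 4 \<le> norm (sin (of_real pi * z))" if "z \<in> closed_segment p q" for z
    proof -
      have quarter_le: "u / 4 \<le> (u - v) / 2" if "2 \<le> u" "v \<le> 1" for u v :: real
        using that by simp
      have "pi * T \<ge> 1"
        using \<open>T \<ge> 1\<close> pi_ge_two mult_mono[of 1 pi 1 T] by simp
      then have "exp (pi * T) \<ge> 2" "exp (- (pi * T)) \<le> 1"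
        using exp_ge_add_one_self[of "pi * T"] by (linarith, simp)
      then have "exp (pi * T) / 4 \<le> sinh (pi * T)"
        using quarter_le[of "exp (pi * T)" "exp (- (pi * T))"] by (simp only: sinh_field_def)
      also have "\<dots> = \<bar>sinh (Im (of_real pi * z))\<bar>"
        using seg[OF that] by (simp add: abs_mult flip: sinh_real_abs)
      also have "\<dots> \<le> norm (sin (of_real pi * z))"
        by (rule norm_sin_ge_sinh)
      finally show ?thesis .
    qed
    have "continuous_on (closed_segment p q) ?h"
      by (intro continuous_intros g) (use sin_ge in fastforce)
    then show int: "?h contour_integrable_on linepath p q"
      by (rule contour_integrable_continuous_linepath)
    have "norm (?h z) \<le> 4 * K * pi * exp (- (pi - \<theta>) * T)" if "z \<in> closed_segment p q" for z
    proof -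
      have "norm (?h z) = pi * norm (g z) / norm (sin (of_real pi * z))"
        by (simp add: norm_mult norm_divide)
      also have "\<dots> \<le> pi * (K * exp (\<theta> * T)) / (exp (pi * T) / 4)"
        using bound[of z] seg[OF that] sin_ge[OF that] \<open>K \<ge> 0\<close>
        by (intro frac_le mult_left_mono) auto
      also have "\<dots> = 4 * K * pi * exp (- (pi - \<theta>) * T)"
        by (simp add: left_diff_distrib exp_diff)
      finally show ?thesis .
    qed
    then show "norm (contour_integral (linepath p q) ?h)
        \<le> 4 * K * pi * exp (- (pi - \<theta>) * T) * norm (q - p)"
      using \<open>K \<ge> 0\<close> by (intro contour_integral_bound_linepath int) auto
  qed
  have "norm (?I (1/2) n + ?I (-1/2) n - g 0) \<le> 4 * K * exp (- (pi - \<theta>) * real n)"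
    if "n \<ge> 1" for n
  proof -
    define T where "T = real n"
    have T: "T \<ge> 1" using that by (simp add: T_def)
    let ?a1 = "Complex (-1/2) (-T)" and ?a2 = "Complex (1/2) (-T)"
    let ?a3 = "Complex (1/2) T" and ?a4 = "Complex (-1/2) T"
    have vert: "?h contour_integrable_on linepath (Complex c u) (Complex c v)"
      if "c = 1/2 \<or> c = -1/2" for c u v
    proof (intro contour_integrable_continuous_linepath continuous_intros g ballI)
      fix z assume "z \<in> closed_segment (Complex c u) (Complex c v)"
      then have "Re z = c" by (auto simp: closed_segment_same_Re)
      then show "sin (of_real pi * z) \<noteq> 0"
        using that sin_pi_eq_0_strip[of z] by auto
    qed
    have right: "contour_integral (linepath ?a2 ?a3) ?h = 2 * of_real pi * \<i> * ?I (1/2) n"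
    proof -
      have "contour_integral (linepath ?a2 ?a3) ?h = \<i> * integral {-T..T} (\<lambda>y. ?h (Complex (1/2) y))"
        using T by (intro contour_integral_linepath_same_Re) auto
      also have "(\<lambda>y. ?h (Complex (1/2) y)) = (\<lambda>y. (2 * of_real pi) * ?f (1/2) y)"
        by (simp add: sin_pi_half_line)
      also have "integral {-T..T} \<dots> = (2 * of_real pi) * ?I (1/2) n"
        by (simp only: T_def integral_mult_right)
      finally show ?thesis
        by (simp only: mult_ac)
    qed
    have left: "contour_integral (linepath ?a4 ?a1) ?h = 2 * of_real pi * \<i> * ?I (-1/2) n"
    proof -
      have "contour_integral (linepath ?a4 ?a1) ?h = - contour_integral (linepath ?a1 ?a4) ?h"
        by (rule contour_integral_reverse_linepath)
          (auto intro!: continuous_intros g sin_pi_eq_0_strip simp: closed_segment_same_Re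
             dest: sin_pi_eq_0_strip[rotated])
      also have "contour_integral (linepath ?a1 ?a4) ?h
          = \<i> * integral {-T..T} (\<lambda>y. ?h (Complex (-1/2) y))"
        using T by (intro contour_integral_linepath_same_Re) auto
      also have "(\<lambda>y. ?h (Complex (-1/2) y)) = (\<lambda>y. (- 2 * of_real pi) * ?f (-1/2) y)"
        by (simp add: sin_pi_half_line)
      also have "integral {-T..T} \<dots> = (- 2 * of_real pi) * ?I (-1/2) n"
        by (simp only: T_def integral_mult_right)
      also have "- (\<i> * \<dots>) = 2 * of_real pi * \<i> * ?I (-1/2) n"
        by (simp only: mult_minus_left mult_minus_right minus_minus mult_ac)
      finally show ?thesis .
    qed
    have width: "norm (?a2 - ?a1) = 1" "norm (?a4 - ?a3) = 1"
      by (simp_all add: cmod_def)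
    have bottom: "norm (contour_integral (linepath ?a1 ?a2) ?h) \<le> 4 * K * pi * exp (- (pi - \<theta>) * T)"
      using horizontal[of T ?a1 ?a2] T unfolding width by simp
    have top: "norm (contour_integral (linepath ?a3 ?a4) ?h) \<le> 4 * K * pi * exp (- (pi - \<theta>) * T)"
      using horizontal[of T ?a3 ?a4] T unfolding width by simp
    have i: "?h contour_integrable_on linepath ?a1 ?a2" "?h contour_integrable_on linepath ?a2 ?a3"
      "?h contour_integrable_on linepath ?a3 ?a4" "?h contour_integrable_on linepath ?a4 ?a1"
      using integrable[of T ?a1 ?a2] integrable[of T ?a3 ?a4] vert T by auto
    have "2 * of_real pi * \<i> * g 0 = contour_integral (rectpath ?a1 ?a3) ?h"
      using T by (intro contour_integral_rectpath_pi_over_sin[OF holo, symmetric]) auto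
    also have "\<dots> = contour_integral (linepath ?a1 ?a2) ?h + contour_integral (linepath ?a2 ?a3) ?h
        + contour_integral (linepath ?a3 ?a4) ?h + contour_integral (linepath ?a4 ?a1) ?h"
      using i by (simp add: rectpath_def Let_def)
    finally have "2 * of_real pi * \<i> * (?I (1/2) n + ?I (-1/2) n - g 0)
        = - (contour_integral (linepath ?a1 ?a2) ?h + contour_integral (linepath ?a3 ?a4) ?h)"
      unfolding left right by (simp add: algebra_simps)
    then have "norm (2 * of_real pi * \<i> * (?I (1/2) n + ?I (-1/2) n - g 0))
        = norm (contour_integral (linepath ?a1 ?a2) ?h + contour_integral (linepath ?a3 ?a4) ?h)"
      by (simp only: norm_minus_cancel)
    moreover have "norm (2 * of_real pi * \<i> * w) = 2 * pi * norm w" for w :: complex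
      by (simp add: norm_mult)
    ultimately have "2 * pi * norm (?I (1/2) n + ?I (-1/2) n - g 0)
        = norm (contour_integral (linepath ?a1 ?a2) ?h + contour_integral (linepath ?a3 ?a4) ?h)"
      by simp
    also have "\<dots> \<le> 2 * pi * (4 * K * exp (- (pi - \<theta>) * T))"
      using norm_triangle_mono[OF bottom top] by (simp add: algebra_simps)
    finally show ?thesis
      by (simp add: T_def)
  qed
  then have "\<forall>\<^sub>F n in sequentially.
      norm (?I (1/2) n + ?I (-1/2) n - g 0) \<le> 4 * K * exp (- (pi - \<theta>) * real n)"
    using eventually_ge_at_top[of 1] by (rule eventually_mono[rotated])
  moreover have "(\<lambda>n. 4 * K * exp (- (pi - \<theta>) * real n)) \<longlonglongrightarrow> 0"
  proof -
    have "exp (- (pi - \<theta>)) < 1" using \<open>\<theta> < pi\<close> by simp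
    then have "(\<lambda>n. exp (- (pi - \<theta>)) ^ n) \<longlonglongrightarrow> 0"
      by (intro LIMSEQ_realpow_zero) auto
    then show ?thesis
      by (intro tendsto_mult_right_zero) (simp add: exp_of_nat_mult[symmetric] mult.commute)
  qed
  ultimately have "(\<lambda>n. ?I (1/2) n + ?I (-1/2) n - g 0) \<longlonglongrightarrow> 0"
    by (rule Lim_null_comparison)
  then have "0 = integral UNIV (?f (1/2)) + integral UNIV (?f (-1/2)) - g 0"
  proof (rule LIMSEQ_unique)
    show "(\<lambda>n. ?I (1/2) n + ?I (-1/2) n - g 0)
      \<longlonglongrightarrow> integral UNIV (?f (1/2)) + integral UNIV (?f (-1/2)) - g 0"
      by (intro tendsto_intros lim) auto
  qed
  then show ?thesis
    by (simp only: eq_diff_eq add_0_left)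
qed

section \<open>The Mellin--Barnes integral\<close>

text \<open>With \<open>s = 1/2 + \<i> y\<close> and \<open>sin (pi s) = cosh (pi y)\<close> this is the Mellin--Barnes integral
\<open>1 / (2 pi \<i>) \<integral> pi / sin (pi s) \<cdot> t powr (- s) / Gamma (b - a s) ds\<close> over the line \<open>Re s = 1/2\<close>.
It makes sense also for \<open>b \<le> 0\<close>, which the decay estimate exploits.\<close>
definition mellin_barnes :: "real \<Rightarrow> real \<Rightarrow> real \<Rightarrow> complex" where
  "mellin_barnes a b t =
     integral UNIV (\<lambda>y. of_real t powr (- Complex (1/2) y) * rGamma (of_real b - of_real a * Complex (1/2) y)
                         / of_real (2 * cosh (pi * y)))"

lemma norm_powr_minus_le:
  assumes "t \<ge> 1" "- Re s \<le> 1/2"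
  shows "norm (of_real t powr (- s)) \<le> sqrt t"
  using assms by (simp add: norm_powr_real_powr powr_mono flip: powr_half_sqrt)

text \<open>The last factor depends on \<open>a\<close> only through its upper bound \<open>\<alpha>\<close>; this is where uniformity in the
parameters comes from.\<close>
lemma norm_mellin_barnes_le:
  assumes a: "0 \<le> a" "a \<le> \<alpha>" "\<alpha> < 1" and t: "t \<ge> 1"
    and bound: "\<And>y. norm (rGamma (Complex (b - a/2) y)) \<le> M * exp (pi * \<bar>y\<bar>)"
  shows "norm (mellin_barnes a b t) \<le> M * integral UNIV (\<lambda>y. exp (- (pi - pi * \<alpha>) * \<bar>y\<bar>))"
  unfolding mellin_barnes_def
proof (rule norm_sech_weighted_integral_le)
  show "continuous_on UNIV (\<lambda>y. of_real t powr (- Complex (1/2) y)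
          * rGamma (of_real b - of_real a * Complex (1/2) y))"
    using t by (intro continuous_intros continuous_on_compose2[OF continuous_on_rGamma[of UNIV]]) auto
  show "pi * \<alpha> < pi" using a by simp
  fix y
  have "M \<ge> 0" using order_trans[OF norm_ge_zero bound[of 0]] by simp
  have "norm (of_real t powr (- Complex (1/2) y)) \<le> 1"
    using t powr_mono[of "-1/2" 0 t] by (simp add: norm_powr_real_powr)
  moreover have "norm (rGamma (of_real b - of_real a * Complex (1/2) y)) \<le> M * exp (pi * \<alpha> * \<bar>y\<bar>)"
  proof -
    have "of_real b - of_real a * Complex (1/2) y = Complex (b - a/2) (- (a * y))"
      by (simp add: complex_eq_iff)
    then have "norm (rGamma (of_real b - of_real a * Complex (1/2) y)) \<le> M * exp (pi * \<bar>a * y\<bar>)"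
      using bound[of "- (a * y)"] by simp
    also have "\<dots> \<le> M * exp (pi * \<alpha> * \<bar>y\<bar>)"
      using a \<open>M \<ge> 0\<close> by (intro mult_left_mono) (auto simp: abs_mult mult_right_mono)
    finally show ?thesis .
  qed
  ultimately have "norm (of_real t powr (- Complex (1/2) y)) * norm (rGamma (of_real b - of_real a * Complex (1/2) y))
      \<le> 1 * (M * exp (pi * \<alpha> * \<bar>y\<bar>))"
    by (rule mult_mono) auto
  then show "norm (of_real t powr (- Complex (1/2) y) * rGamma (of_real b - of_real a * Complex (1/2) y))
      \<le> M * exp (pi * \<alpha> * \<bar>y\<bar>)"
    by (simp only: norm_mult mult_1_left)
qed

text \<open>The strip formula for the entire function \<open>s \<mapsto> t powr (- s) * rGamma (b - a s)\<close>. Its value at the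
origin is \<open>rGamma b\<close>, and the integral over \<open>Re s = -1/2\<close> becomes one over \<open>Re s = 1/2\<close> when \<open>s\<close> is
replaced by \<open>s - 1\<close>, which trades a factor \<open>t\<close> for the shift from \<open>b\<close> to \<open>b + a\<close>.\<close>
lemma mellin_barnes_recurrence:
  assumes a: "0 \<le> a" "a < 1" and b: "b \<ge> -1" and t: "t \<ge> 1"
  shows "mellin_barnes a b t = of_real (rGamma b) - of_real t * mellin_barnes a (b + a) t"
proof -
  obtain B where B: "B \<ge> 0"
    "\<And>x y. -2 \<le> x \<Longrightarrow> norm (rGamma (Complex x y)) \<le> B * exp (pi * \<bar>y\<bar>)"
    using rGamma_strip_bound by blast
  let ?g = "\<lambda>s. of_real t powr (- s) * rGamma (of_real b - of_real a * s) :: complex"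
  have "?g holomorphic_on UNIV"
    using t by (intro holomorphic_intros) auto
  moreover have "pi * a < pi" using a by simp
  moreover have "norm (?g s) \<le> sqrt t * B * exp (pi * a * \<bar>Im s\<bar>)" if s: "\<bar>Re s\<bar> \<le> 1/2" for s
  proof -
    have "of_real b - of_real a * s = Complex (b - a * Re s) (- (a * Im s))"
      by (simp add: complex_eq_iff)
    moreover have "a * Re s \<le> a * (1/2)"
      using s a by (intro mult_left_mono) auto
    then have "-2 \<le> b - a * Re s"
      using a b by linarith
    ultimately have "norm (rGamma (of_real b - of_real a * s)) \<le> B * exp (pi * a * \<bar>Im s\<bar>)"
      using B(2)[of "b - a * Re s" "- (a * Im s)"] a b by (simp add: abs_mult mult.assoc)
    then have "norm (?g s) \<le> sqrt t * (B * exp (pi * a * \<bar>Im s\<bar>))"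
      unfolding norm_mult using s t by (intro mult_mono norm_powr_minus_le) auto
    then show ?thesis by (simp add: mult.assoc)
  qed
  ultimately have "?g 0 = integral UNIV (\<lambda>y. ?g (Complex (1/2) y) / of_real (2 * cosh (pi * y)))
      + integral UNIV (\<lambda>y. ?g (Complex (-1/2) y) / of_real (2 * cosh (pi * y)))"
    by (rule strip_mean_value)
  also have "(\<lambda>y. ?g (Complex (-1/2) y) / of_real (2 * cosh (pi * y)))
      = (\<lambda>y. of_real t * (of_real t powr (- Complex (1/2) y)
           * rGamma (of_real (b + a) - of_real a * Complex (1/2) y) / of_real (2 * cosh (pi * y))))"
  proof
    fix y
    have shift: "Complex (-1/2) y = Complex (1/2) y - 1"
      by (simp add: complex_eq_iff)
    have "of_real t powr (1 - Complex (1/2) y) = of_real t * of_real t powr (- Complex (1/2) y)"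
      using t by (simp add: powr_diff powr_minus divide_simps)
    moreover have "of_real b - of_real a * (Complex (1/2) y - 1) = of_real (b + a) - of_real a * Complex (1/2) y"
      by (simp add: algebra_simps)
    ultimately show "?g (Complex (-1/2) y) / of_real (2 * cosh (pi * y))
      = of_real t * (of_real t powr (- Complex (1/2) y)
           * rGamma (of_real (b + a) - of_real a * Complex (1/2) y) / of_real (2 * cosh (pi * y)))"
      unfolding shift minus_diff_eq by (simp only: mult.assoc times_divide_eq_right)
  qed
  also have "integral UNIV \<dots> = of_real t * mellin_barnes a (b + a) t"
    unfolding mellin_barnes_def by (rule integral_mult_right)
  finally show ?thesis
    using t by (simp add: rGamma_complex_of_real mellin_barnes_def[of a b])
qed

text \<open>Iterating the recurrence produces the partial sums of the Mittag-Leffler series. In the remainder,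
\<open>b\<close> has grown to \<open>b + n a\<close>, and the superexponential decay of \<^term>\<open>rGamma\<close> defeats the factor \<open>t ^ n\<close>.\<close>
lemma mittag_leffler_eq_mellin_barnes:
  assumes a: "0 < a" "a < 1" and b: "b > 0" and t: "t \<ge> 1"
  shows "mittag_leffler a b (of_real (- t)) = mellin_barnes a b t"
proof -
  \<comment> \<open>Chosen so that \<open>D powr (n a) = (2 t) ^ n\<close>: the remainder is then \<open>O ((1/2) ^ n)\<close>.\<close>
  define D where "D = (2 * t) powr (1/a)"
  have D: "D \<ge> 1"
    unfolding D_def using a t by (intro ge_one_powr_ge_zero) auto
  obtain B where B: "B \<ge> 0"
    "\<And>x y. -2 \<le> x \<Longrightarrow> norm (rGamma (Complex x y)) \<le> B * exp (pi * \<bar>y\<bar>) * D powr (-x)"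
    using rGamma_superexponential_bound[OF D] by blast
  define I where "I = integral UNIV (\<lambda>y::real. exp (- (pi - pi * a) * \<bar>y\<bar>))"
  let ?term = "\<lambda>k. of_real (- t) ^ k / of_real (Gamma (a * real k + b)) :: complex"
  have partial: "mellin_barnes a b t = (\<Sum>k<n. ?term k) + of_real (- t) ^ n * mellin_barnes a (b + real n * a) t" for n
  proof (induction n)
    case 0 then show ?case by simp
  next
    case (Suc n)
    have "mellin_barnes a (b + real n * a) t
        = of_real (rGamma (b + real n * a)) - of_real t * mellin_barnes a (b + real n * a + a) t"
      using a b t mult_nonneg_nonneg[of "real n" a] by (intro mellin_barnes_recurrence) linarith+
    then have "mellin_barnes a (b + real n * a) t
        = 1 / of_real (Gamma (a * real n + b)) + of_real (- t) * mellin_barnes a (b + real (Suc n) * a) t"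
      by (simp add: rGamma_inverse_Gamma algebra_simps divide_inverse)
    with Suc show ?case
      by (simp add: ring_distribs)
  qed
  have rest: "norm (of_real (- t) ^ n * mellin_barnes a (b + real n * a) t)
      \<le> (B * D powr (a/2 - b) * I) * (1/2) ^ n" for n
  proof -
    have "norm (mellin_barnes a (b + real n * a) t) \<le> (B * D powr (- (b + real n * a - a/2))) * I"
      unfolding I_def
    proof (rule norm_mellin_barnes_le)
      fix y
      have "-2 \<le> b + real n * a - a/2"
        using a b mult_nonneg_nonneg[of "real n" a] by linarith
      then show "norm (rGamma (Complex (b + real n * a - a/2) y))
          \<le> B * D powr (- (b + real n * a - a/2)) * exp (pi * \<bar>y\<bar>)"
        using B(2)[of "b + real n * a - a/2" y] by (simp add: mult_ac)
    qed (use a t in auto)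
    moreover have "D powr (- (b + real n * a - a/2)) = D powr (a/2 - b) * (1 / (2 * t)) ^ n"
    proof -
      have "D powr (- (b + real n * a - a/2)) = D powr (a/2 - b) / D powr (real n * a)"
        by (simp flip: powr_diff add: algebra_simps)
      also have "D powr (real n * a) = (2 * t) ^ n"
        using a t by (simp add: D_def powr_powr powr_realpow)
      finally show ?thesis by (simp add: power_divide)
    qed
    ultimately have "t ^ n * norm (mellin_barnes a (b + real n * a) t)
        \<le> t ^ n * (B * (D powr (a/2 - b) * (1 / (2 * t)) ^ n) * I)"
      using t by (intro mult_left_mono) auto
    also have "\<dots> = (B * D powr (a/2 - b) * I) * (1/2) ^ n"
      using t by (simp add: power_divide power_mult_distrib)
    finally show ?thesis
      using t by (simp add: norm_mult norm_power)
  qed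
  have "(\<lambda>n. (B * D powr (a/2 - b) * I) * (1/2) ^ n) \<longlonglongrightarrow> 0"
    by (intro tendsto_mult_right_zero LIMSEQ_realpow_zero) auto
  then have "(\<lambda>n. of_real (- t) ^ n * mellin_barnes a (b + real n * a) t) \<longlonglongrightarrow> 0"
    by (rule Lim_null_comparison[OF always_eventually[OF allI[OF rest]]])
  then have "(\<lambda>n. mellin_barnes a b t - of_real (- t) ^ n * mellin_barnes a (b + real n * a) t)
      \<longlonglongrightarrow> mellin_barnes a b t - 0"
    by (intro tendsto_intros)
  moreover have "mellin_barnes a b t - of_real (- t) ^ n * mellin_barnes a (b + real n * a) t
      = (\<Sum>k<n. ?term k)" for n
    using partial[of n] by (simp add: algebra_simps)
  ultimately have "?term sums mellin_barnes a b t"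
    by (simp add: sums_def)
  then show ?thesis
    unfolding mittag_leffler_def by (simp add: sums_iff)
qed

section \<open>Uniform bounds for the Mittag-Leffler function\<close>

text \<open>The recurrence at \<open>b - a\<close> instead of \<open>b\<close> expresses \<open>t\<close> times the function through \<open>rGamma (b - a)\<close> and
the Mellin--Barnes integral with parameter \<open>b - a > -1\<close>, and both are bounded.\<close>
lemma mittag_leffler_decay:
  assumes "0 \<le> \<alpha>" "\<alpha> < 1"
  shows "\<exists>C\<ge>0. \<forall>a b t. 0 < a \<longrightarrow> a \<le> \<alpha> \<longrightarrow> 0 < b \<longrightarrow> 1 \<le> t \<longrightarrow>
    norm (mittag_leffler a b (of_real (- t))) \<le> C / t"
proof -
  obtain B where B: "B \<ge> 0"
    "\<And>x y. -2 \<le> x \<Longrightarrow> norm (rGamma (Complex x y)) \<le> B * exp (pi * \<bar>y\<bar>)"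
    using rGamma_strip_bound by blast
  define I where "I = integral UNIV (\<lambda>y::real. exp (- (pi - pi * \<alpha>) * \<bar>y\<bar>))"
  have I: "I \<ge> 0"
    unfolding I_def by (intro integral_nonneg integrable_exp_minus_abs) (use assms in auto)
  show ?thesis
  proof (intro exI[of _ "B + B * I"] conjI allI impI)
    show "B + B * I \<ge> 0" using B(1) I by simp
    fix a b t :: real
    assume a: "0 < a" "a \<le> \<alpha>" and b: "0 < b" and t: "1 \<le> t"
    have "mellin_barnes a (b - a) t = of_real (rGamma (b - a)) - of_real t * mellin_barnes a (b - a + a) t"
      using a b t assms by (intro mellin_barnes_recurrence) auto
    then have "of_real t * mittag_leffler a b (of_real (- t)) = of_real (rGamma (b - a)) - mellin_barnes a (b - a) t"
      using a b t assms by (subst mittag_leffler_eq_mellin_barnes) auto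
    then have "t * norm (mittag_leffler a b (of_real (- t)))
        = norm (of_real (rGamma (b - a)) - mellin_barnes a (b - a) t)"
      using t by (metis abs_of_nonneg norm_mult norm_of_real order_trans zero_le_one)
    also have "\<dots> \<le> norm (of_real (rGamma (b - a)) :: complex) + norm (mellin_barnes a (b - a) t)"
      by (rule norm_triangle_ineq4)
    also have "\<dots> \<le> B + B * I"
    proof (rule add_mono)
      show "norm (of_real (rGamma (b - a)) :: complex) \<le> B"
        using B(2)[of "b - a" 0] a b assms by (simp flip: rGamma_complex_of_real complex_of_real_def)
      show "norm (mellin_barnes a (b - a) t) \<le> B * I"
        unfolding I_def using a b t assms by (intro norm_mellin_barnes_le B(2)) auto
    qed
    finally show "norm (mittag_leffler a b (of_real (- t))) \<le> (B + B * I) / t"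
      using t by (simp add: field_simps)
  qed
qed

text \<open>The decay of \<^term>\<open>rGamma\<close> on the real axis dominates the coefficients by a geometric series that does
not depend on the parameters.\<close>
lemma mittag_leffler_bounded_unit_disc:
  assumes "0 < \<alpha>"
  shows "\<exists>C\<ge>0. \<forall>a b z. \<alpha> \<le> a \<longrightarrow> 0 \<le> b \<longrightarrow> norm z \<le> 1 \<longrightarrow> norm (mittag_leffler a b z) \<le> C"
proof -
  \<comment> \<open>Gives the ratio \<open>1/2\<close>: \<open>D powr (- \<alpha> k) = (1/2) ^ k\<close>.\<close>
  define D :: real where "D = 2 powr (1/\<alpha>)"
  have D: "D \<ge> 1"
    unfolding D_def using assms by (intro ge_one_powr_ge_zero) auto
  obtain B where B: "B \<ge> 0"
    "\<And>x y. -2 \<le> x \<Longrightarrow> norm (rGamma (Complex x y)) \<le> B * exp (pi * \<bar>y\<bar>) * D powr (-x)"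
    using rGamma_superexponential_bound[OF D] by blast
  show ?thesis
  proof (intro exI[of _ "B * 2"] conjI allI impI)
    fix a b :: real and z :: complex
    assume a: "\<alpha> \<le> a" and b: "0 \<le> b" and z: "norm z \<le> 1"
    have le: "norm (z ^ k / of_real (Gamma (a * real k + b))) \<le> B * (1/2) ^ k" for k
    proof -
      have nonneg: "a * real k + b \<ge> 0" using a b assms by simp
      have "norm (z ^ k / of_real (Gamma (a * real k + b)))
          = norm z ^ k * norm (rGamma (Complex (a * real k + b) 0))"
        by (simp only: norm_mult norm_power rGamma_inverse_Gamma divide_inverse
            complex_of_real_def[symmetric] Gamma_complex_of_real)
      also have "\<dots> \<le> 1 * (B * D powr (- (a * real k + b)))"
        using z nonneg B(2)[of "a * real k + b" 0] by (intro mult_mono power_le_one) auto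
      also have "\<dots> \<le> B * D powr (- (\<alpha> * real k))"
        using a b D B(1) mult_right_mono[of \<alpha> a "real k"] by (auto intro!: mult_left_mono powr_mono)
      also have "D powr (- (\<alpha> * real k)) = 2 powr (- real k)"
        using assms by (simp add: D_def powr_powr)
      also have "\<dots> = (1/2) ^ k"
        by (simp add: powr_minus_divide powr_realpow power_one_over)
      finally show ?thesis .
    qed
    have "summable (\<lambda>k. B * (1/2) ^ k)"
      by (intro summable_mult summable_geometric) auto
    then have "norm (mittag_leffler a b z) \<le> (\<Sum>k. B * (1/2) ^ k)"
      unfolding mittag_leffler_def by (rule norm_suminf_le[OF le])
    also have "\<dots> = B * 2"
      by (subst suminf_mult) (auto simp: suminf_geometric)
    finally show "norm (mittag_leffler a b z) \<le> B * 2" .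
  qed (use B(1) in auto)
qed

theorem lemmaA1:
  fixes a_lo a_hi b_lo b_hi :: real
  assumes "0 < a_lo" and "a_lo < a_hi" and "a_hi < 1"
    and "0 < b_lo" and "b_lo < b_hi"
  shows "\<exists>C::real. C > 0 \<and>
    (\<forall>t\<ge>0. \<forall>a\<in>{a_lo..a_hi}. \<forall>b\<in>{b_lo..b_hi}.
       cmod (mittag_leffler a b (complex_of_real (- t))) \<le> C / (1 + t))"
proof -
  have a_hi_nonneg: "0 \<le> a_hi" using assms by simp
  obtain C1 where C1: "C1 \<ge> 0"
    "\<And>a b t. 0 < a \<Longrightarrow> a \<le> a_hi \<Longrightarrow> 0 < b \<Longrightarrow> 1 \<le> t \<Longrightarrow>
       norm (mittag_leffler a b (of_real (- t))) \<le> C1 / t"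
    using mittag_leffler_decay[OF a_hi_nonneg assms(3)] by blast
  obtain C2 where C2: "C2 \<ge> 0"
    "\<And>a b z. a_lo \<le> a \<Longrightarrow> 0 \<le> b \<Longrightarrow> norm z \<le> 1 \<Longrightarrow> norm (mittag_leffler a b z) \<le> C2"
    using mittag_leffler_bounded_unit_disc[OF assms(1)] by blast
  define C where "C = 2 * (C1 + C2 + 1)"
  have "norm (mittag_leffler a b (of_real (- t))) \<le> C / (1 + t)"
    if t: "t \<ge> 0" and a: "a \<in> {a_lo..a_hi}" and b: "b \<in> {b_lo..b_hi}" for t a b
  proof (cases "t \<le> 1")
    case True
    have "norm (mittag_leffler a b (of_real (- t))) \<le> C2"
      using True t a b assms by (intro C2(2)) auto
    also have "\<dots> \<le> C / 2" using C1(1) by (simp add: C_def)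
    also have "\<dots> \<le> C / (1 + t)"
      using True t C1(1) C2(1) by (intro divide_left_mono) (auto simp: C_def)
    finally show ?thesis .
  next
    case False
    have "norm (mittag_leffler a b (of_real (- t))) \<le> C1 / t"
      using False t a b assms by (intro C1(2)) auto
    also have "\<dots> = 2 * C1 / (2 * t)" by simp
    also have "\<dots> \<le> C / (1 + t)"
      using False C1(1) C2(1) by (intro frac_le) (auto simp: C_def)
    finally show ?thesis .
  qed
  moreover have "C > 0" using C1(1) C2(1) by (simp add: C_def)
  ultimately show ?thesis by blast
qed

end
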